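(* Let $D$ be a digraph with positive complexity. Then the normalized volume of $P_D$ equals the complexity of $D$, i.e. $$\operatorname{Vol}(P_D)=c(D).$$
   Context: A digraph $D$ is a finite directed graph on the vertex set $[n]=\{1,\ldots,n\}$, without loops and without isolated vertices (vertices with indegree and outdegree both zero); multiple directed edges are allowed. A directed edge $(i,j)$ has tail $i$ and head $j$. Let $a_{i,j}$ be the number of edges with tail $i$ and head $j$ (so $a_{i,i}=0$), and let $\mathrm{outdeg}(i)=\sum_j a_{i,j}$. The Laplacian matrix of $D$ is $L(D)=O(D)-A(D)$, where $A(D)=(a_{i,j})$ and $O(D)$ is the diagonal matrix with entries $\mathrm{outdeg}(i)$. The Laplacian polytope of $D$ is $P_D=\operatorname{conv}\{\mathbf{v}_1,\ldots,\mathbf{v}_n\}\subset\mathbb{R}^n$, where $\mathbf{v}_i$ is the $i$-th row of $L(D)$. It lies in the hyperplane $H=\{\mathbf{x}\in\mathbb{R}^n:\sum_i x_i=0\}$. A converging tree is a digraph whose underlying undirected graph is connected and that has one vertex of outdegree zero (its root), all other vertices having outdegree one. A subgraph of $D$ is spanning if its vertex set is $[n]$. The complexity $c(D)$ of $D$ is the total number of spanning converging trees of $D$ (parallel edges are regarded as distinct); $D$ has positive complexity if $c(D)>0$. In that case $P_D$ has dimension $n-1$. The normalized volume of a $d$-dimensional polytope in $\mathbb{R}^d$ is $d!$ times its Euclidean volume. For $P_D$, of dimension $n-1$ in $H$, it is taken with respect to the lattice $H\cap\mathbb{Z}^n$: equivalently, $\operatorname{Vol}(P_D)$ is the normalized volume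 of the full-dimensional polytope in $\mathbb{R}^{n-1}$ obtained as the convex hull of the rows of $L(D)$ with one (arbitrary) column deleted. *)

theory Defs
  imports "HOL-Analysis.Analysis" "Graph_Theory.Graph_Theory"
begin

text \<open>
  A digraph with parallel arcs on the vertex set \<open>UNIV :: 'n::finite set\<close> (playing the role of
  \<open>{1,...,n}\<close>, with \<open>n = CARD('n)\<close>) is a Graph_Theory multigraph \<open>D :: ('n, 'e) pre_digraph\<close>;
  \<open>digraph\<close> of that library excludes parallel arcs and is therefore not used.
\<close>

locale multi_digraph = fin_digraph D + loopfree_digraph D
  for D :: "('n::finite, 'e) pre_digraph" +
  assumes verts_UNIV: "verts D = UNIV"
    and no_isolated: "v \<in> verts D \<Longrightarrow> in_degree D v \<noteq> 0 \<or> out_degree D v \<noteq> 0"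

definition adjacency_matrix :: "('n::finite, 'e) pre_digraph \<Rightarrow> real^'n^'n" where
  "adjacency_matrix D = (\<chi> i j. real (card {e \<in> arcs D. tail D e = i \<and> head D e = j}))"

definition outdegree_matrix :: "('n::finite, 'e) pre_digraph \<Rightarrow> real^'n^'n" where
  "outdegree_matrix D = (\<chi> i j. if i = j then real (out_degree D i) else 0)"

definition laplacian :: "('n::finite, 'e) pre_digraph \<Rightarrow> real^'n^'n" where
  "laplacian D = outdegree_matrix D - adjacency_matrix D"

definition laplacian_polytope :: "('n::finite, 'e) pre_digraph \<Rightarrow> (real^'n) set" where
  "laplacian_polytope D = convex hull (rows (laplacian D))"

text \<open>
  \<open>Digraph_Component.connected\<close> is connectedness of the underlying undirected graph; the
  qualified name is needed because \<open>connected\<close> is also the topological notion.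
\<close>

definition converging_tree :: "('a, 'b) pre_digraph \<Rightarrow> bool" where
  "converging_tree T \<longleftrightarrow> fin_digraph T \<and> loopfree_digraph T \<and> Digraph_Component.connected T \<and>
     (\<exists>r \<in> verts T. out_degree T r = 0 \<and> (\<forall>v \<in> verts T - {r}. out_degree T v = 1))"

text \<open>
  A subgraph keeps the \<open>tail\<close> and \<open>head\<close> functions of \<open>D\<close>, so a spanning subgraph is determined by
  its set of arcs, and choosing a different parallel arc gives a different tree.
\<close>

definition complexity :: "('a, 'b) pre_digraph \<Rightarrow> nat" where
  "complexity D = card {T. spanning T D \<and> converging_tree T}"

text \<open>
  The Euclidean space of dimension \<open>card I\<close> is represented by the extensional functions on the
  finite index set \<open>I\<close>, with the product Lebesgue measure.
\<close>

definition normalized_volume :: "'i set \<Rightarrow> ('i \<Rightarrow> real) set \<Rightarrow> real" where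
  "normalized_volume I S = fact (card I) * measure (\<Pi>\<^sub>M i\<in>I. lborel) S"

definition delete_coordinate :: "'n \<Rightarrow> real^'n \<Rightarrow> 'n \<Rightarrow> real" where
  "delete_coordinate k x = restrict (\<lambda>i. x $ i) (- {k})"

definition zero_sum_hyperplane :: "(real^'n::finite) set" where
  "zero_sum_hyperplane = {x. (\<Sum>i\<in>UNIV. x $ i) = 0}"

text \<open>
  Normalized volume, with respect to the lattice of integer points of the hyperplane of vectors
  with coordinate sum zero, of a set contained in that hyperplane. Deleting the coordinate \<open>k\<close>
  identifies this lattice with the standard lattice in the remaining coordinates, see
  \<open>bij_betw_delete_coordinate_lattice\<close> below. The choice of \<open>k\<close> is a parameter.
\<close>

definition hyperplane_volume :: "'n::finite \<Rightarrow> (real^'n) set \<Rightarrow> real" where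
  "hyperplane_volume k P = normalized_volume (- {k}) (delete_coordinate k ` P)"

lemma bij_betw_delete_coordinate:
  fixes k :: "'n::finite"
  shows "bij_betw (delete_coordinate k) zero_sum_hyperplane (- {k} \<rightarrow>\<^sub>E UNIV)"
proof (rule bij_betwI[where g = "\<lambda>y. \<chi> i. if i = k then - sum y (- {k}) else y i"])
  have split: "sum f UNIV = f k + sum f (- {k})" for f :: "'n \<Rightarrow> real"
    by (simp add: sum.remove[of UNIV k] Compl_eq_Diff_UNIV)
  show "delete_coordinate k \<in> zero_sum_hyperplane \<rightarrow> (- {k} \<rightarrow>\<^sub>E UNIV)"
    by (auto simp: delete_coordinate_def)
  show "(\<lambda>y. \<chi> i. if i = k then - sum y (- {k}) else y i) \<in>
      (- {k} \<rightarrow>\<^sub>E UNIV) \<rightarrow> zero_sum_hyperplane"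
    by (auto simp: zero_sum_hyperplane_def split)
  show "(\<chi> i. if i = k then - sum (delete_coordinate k x) (- {k}) else delete_coordinate k x i) = x"
    if "x \<in> zero_sum_hyperplane" for x
    using that by (auto simp: zero_sum_hyperplane_def delete_coordinate_def vec_eq_iff split)
  show "delete_coordinate k (\<chi> i. if i = k then - sum y (- {k}) else y i) = y"
    if "y \<in> - {k} \<rightarrow>\<^sub>E UNIV" for y
    using that by (auto simp: delete_coordinate_def fun_eq_iff PiE_def extensional_def)
qed

lemma bij_betw_delete_coordinate_lattice:
  fixes k :: "'n::finite"
  shows "bij_betw (delete_coordinate k)
    (zero_sum_hyperplane \<inter> {x. \<forall>i. x $ i \<in> \<int>}) (- {k} \<rightarrow>\<^sub>E \<int>)"
proof (rule bij_betw_imageI)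
  let ?L = "zero_sum_hyperplane \<inter> {x::real^'n. \<forall>i. x $ i \<in> \<int>}"
  show "inj_on (delete_coordinate k) ?L"
    using bij_betw_delete_coordinate[of k] by (auto simp: bij_betw_def intro: inj_on_subset)
  show "delete_coordinate k ` ?L = - {k} \<rightarrow>\<^sub>E \<int>"
  proof
    show "delete_coordinate k ` ?L \<subseteq> - {k} \<rightarrow>\<^sub>E \<int>"
      by (auto simp: delete_coordinate_def split: if_splits)
    show "- {k} \<rightarrow>\<^sub>E \<int> \<subseteq> delete_coordinate k ` ?L"
    proof
      fix y :: "'n \<Rightarrow> real"
      assume y: "y \<in> - {k} \<rightarrow>\<^sub>E \<int>"
      then have "y \<in> - {k} \<rightarrow>\<^sub>E UNIV"
        by auto
      then obtain x where x: "x \<in> zero_sum_hyperplane" "y = delete_coordinate k x"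
        using bij_betw_delete_coordinate[of k] unfolding bij_betw_def by blast
      have int: "x $ i \<in> \<int>" if "i \<noteq> k" for i
        using y that by (auto simp: x(2) delete_coordinate_def PiE_def Pi_def)
      have "x $ k = - (\<Sum>i\<in>- {k}. x $ i)"
        using x(1) by (simp add: zero_sum_hyperplane_def sum.remove[of UNIV k] Compl_eq_Diff_UNIV)
      moreover have "(\<Sum>i\<in>- {k}. x $ i) \<in> \<int>"
        using int by (intro Ints_sum) auto
      ultimately have "x $ i \<in> \<int>" for i
        using int by (cases "i = k") auto
      with x show "y \<in> delete_coordinate k ` ?L"
        by auto
    qed
  qed
qed

end

(*
  Write v_i for the rows of L. Deleting coordinate k turns P_D into the image of the standard
  simplex under an affine map whose linear part has the rows v_i - v_k (i distinct from k), so
  Vol(P_D) is the absolute value of its determinant; unimodular row and column operations, together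
  with the vanishing row sums of L, identify it with det M, where M adds 1 to every entry in
  column k of L.

  Row i of M is the sum of e_k and of e_i - e_h over all arcs with tail i and head h. Multilinearity
  expands det M into a sum over all ways to declare each vertex a root or to select one of its
  outgoing arcs. A selection without root or with two roots contributes 0. With exactly one root r,
  it is a map f on the other vertices, and contributes 1 if every vertex reaches r under f and 0
  otherwise. The selections contributing 1 are precisely the spanning converging trees.
*)
theory Submission
  imports Defs
begin

section \<open>Functional matrices\<close>

lemma det_eq_0_if_kernel:
  fixes A :: "real^'n^'n"
  assumes "A *v x = 0" "x \<noteq> 0"
  shows "det A = 0"
  using assms invertible_det_nz[of A] invertible_left_inverse[of A] matrix_left_invertible_ker[of A]
  by blast

definition functional_matrix :: "'n \<Rightarrow> 'n \<Rightarrow> ('n::finite \<Rightarrow> 'n) \<Rightarrow> real^'n^'n" where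
  "functional_matrix k r f = (\<chi> i. if i = r then axis k 1 else axis i 1 - axis (f i) 1)"

text \<open>The pair at \<open>r\<close> is left out because later \<open>f r\<close> will be
  \<open>head D (the None)\<close>, an unspecified vertex.\<close>

definition next_arc :: "'n \<Rightarrow> ('n \<Rightarrow> 'n) \<Rightarrow> ('n \<times> 'n) set" where
  "next_arc r f = {(i, f i) |i. i \<noteq> r}"

text \<open>Only the identity survives in the Leibniz formula. A nonzero term has
  \<open>p i = i\<close> or \<open>p i = f i\<close>, and \<open>p r = r\<close>. If
  \<open>p\<close> fixes \<open>f i\<close>, injectivity rules out \<open>p i = f i\<close>, so
  \<open>i\<close> is fixed too; the claim spreads backwards along the paths to
  \<open>r\<close>.\<close>

lemma det_functional_matrix_self:
  assumes "\<And>i. (i, r) \<in> (next_arc r f)\<^sup>*"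
  shows "det (functional_matrix r r f) = 1"
proof -
  let ?A = "functional_matrix r r f"
  \<comment> \<open>A fixed point other than \<open>r\<close> could never reach \<open>r\<close>.
    Without fixed points the diagonal entries are 1 and do not cancel.\<close>
  have nofix: "f i \<noteq> i" if "i \<noteq> r" for i
  proof
    assume "f i = i"
    have "j = i" if "(i, j) \<in> (next_arc r f)\<^sup>*" for j
      using that by induction (auto simp: next_arc_def \<open>f i = i\<close>)
    with assms[of i] \<open>i \<noteq> r\<close> show False by blast
  qed
  have entry: "?A $ i $ j = (if i = j then 1 else if i \<noteq> r \<and> j = f i then - 1 else 0)" for i j
    using nofix[of i] by (auto simp: functional_matrix_def axis_def)
  have zero: "(\<Prod>i\<in>UNIV. ?A $ i $ p i) = 0" if p: "p permutes UNIV" "p \<noteq> id" for p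
  proof (rule ccontr)
    assume "(\<Prod>i\<in>UNIV. ?A $ i $ p i) \<noteq> 0"
    then have nz: "?A $ i $ p i \<noteq> 0" for i
      by simp
    have "p i = i" if "(i, r) \<in> (next_arc r f)\<^sup>*" for i
      using that
    proof (induction rule: converse_rtrancl_induct)
      case base
      then show ?case using nz[of r] by (auto simp: entry split: if_splits)
    next
      case (step i j)
      then have "j = f i" by (auto simp: next_arc_def)
      moreover have "p i = i \<or> p i = f i"
        using nz[of i] by (auto simp: entry split: if_splits)
      ultimately show ?case
        using step.IH p(1) by (metis permutes_def)
    qed
    with assms p(2) show False by auto
  qed
  have "det ?A = (\<Sum>p\<in>{id}. of_int (sign p) * (\<Prod>i\<in>UNIV. ?A $ i $ p i))"
    unfolding det_def by (rule sum.mono_neutral_right) (auto simp: zero permutes_id)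
  then show ?thesis by (simp add: entry)
qed

text \<open>If all vertices reach \<open>r\<close>, then e_k - e_r telescopes along the path from
  \<open>k\<close> into a sum of rows other than row \<open>r\<close>, so e_k in row
  \<open>r\<close> may be replaced by e_r. Otherwise the matrix has a kernel vector.\<close>

lemma det_functional_matrix:
  "det (functional_matrix k r f) = (if \<forall>i. (i, r) \<in> (next_arc r f)\<^sup>* then 1 else 0)"
proof (cases "\<forall>i. (i, r) \<in> (next_arc r f)\<^sup>*")
  case True
  let ?A = "functional_matrix r r f"
  let ?S = "vec.span {row j ?A |j. j \<noteq> r}"
  have path: "axis i 1 - axis r 1 \<in> ?S" if "(i, r) \<in> (next_arc r f)\<^sup>*" for i
    using that
  proof (induction rule: converse_rtrancl_induct)
    case base
    then show ?case by (simp add: vec.span_zero)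
  next
    case (step i j)
    then have ij: "j = f i" "i \<noteq> r" by (auto simp: next_arc_def)
    have "row i ?A \<in> ?S"
      using ij by (intro vec.span_base) blast
    moreover have "row i ?A = axis i 1 - axis j 1"
      using ij by (simp add: row_def functional_matrix_def vec_eq_iff)
    ultimately show ?case
      using vec.span_add[OF _ step.IH, of "row i ?A"] by simp
  qed
  have "functional_matrix k r f =
      (\<chi> i. if i = r then row r ?A + (axis k 1 - axis r 1) else row i ?A)"
    by (simp add: functional_matrix_def vec_eq_iff row_def)
  then have "det (functional_matrix k r f) = det ?A"
    using det_row_span[OF path] True by simp
  with True det_functional_matrix_self[of r f] show ?thesis by simp
next
  case False
  \<comment> \<open>Away from \<open>r\<close>, both \<open>U\<close> and its complement are invariant under \<open>f\<close> and its inverse, so the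
    indicator vector of whichever of them avoids \<open>k\<close> lies in the kernel.\<close>
  define U where "U = {i. (i, r) \<notin> (next_arc r f)\<^sup>*}"
  \<comment> \<open>A path to \<open>r\<close> from \<open>i\<close>, with \<open>i\<close>
    different from \<open>r\<close>, must begin with the step to \<open>f i\<close>.\<close>
  have closed: "f i \<in> U \<longleftrightarrow> i \<in> U" if "i \<noteq> r" for i
  proof -
    have "(i, f i) \<in> next_arc r f" using that by (auto simp: next_arc_def)
    moreover have "(f i, r) \<in> (next_arc r f)\<^sup>*" if "(i, r) \<in> (next_arc r f)\<^sup>*"
      using that \<open>i \<noteq> r\<close> by (cases rule: converse_rtranclE) (auto simp: next_arc_def)
    ultimately show ?thesis
      by (auto simp: U_def intro: converse_rtrancl_into_rtrancl)
  qed
  define V where "V = (if k \<in> U then - U else U)"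
  have V: "k \<notin> V" "\<And>i. i \<noteq> r \<Longrightarrow> f i \<in> V \<longleftrightarrow> i \<in> V"
    using closed by (auto simp: V_def)
  define x :: "real^'a" where "x = (\<chi> i. indicator V i)"
  \<comment> \<open>\<open>V\<close> is either \<open>U\<close>, nonempty in this case, or its
    complement, which contains \<open>r\<close>.\<close>
  have "r \<notin> U" by (simp add: U_def)
  with False have "V \<noteq> {}" by (auto simp: V_def U_def)
  then have "x \<noteq> 0" by (auto simp: x_def vec_eq_iff indicator_def)
  moreover have "functional_matrix k r f *v x = 0"
  proof -
    have ax: "(\<Sum>j\<in>UNIV. axis i 1 $ j * x $ j) = x $ i" for i
      by (simp add: axis_def if_distrib[of "\<lambda>y. y * _"] cong: if_cong)
    show ?thesis
      using V by (auto simp: vec_eq_iff matrix_vector_mult_def functional_matrix_def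
          left_diff_distrib sum_subtractf ax) (auto simp: x_def indicator_def)
  qed
  ultimately show ?thesis
    using False det_eq_0_if_kernel by auto
qed

section \<open>The matrix-tree expansion\<close>

text \<open>\<open>None\<close> marks the root. These choices will index the nonzero terms of the
  determinant expansion.\<close>

definition tree_choices :: "('n, 'e) pre_digraph \<Rightarrow> ('n \<Rightarrow> 'e option) set" where
  "tree_choices D = {c. \<exists>r. c r = None \<and>
     (\<forall>i. i \<noteq> r \<longrightarrow> (\<exists>e\<in>arcs D. c i = Some e \<and> tail D e = i)) \<and>
     (\<forall>i. (i, r) \<in> (next_arc r (\<lambda>i. head D (the (c i))))\<^sup>*)}"

text \<open>An arc with another tail yields the zero row, so that all vertices choose from one
  common set, as \<open>det_sum_rows\<close> requires.\<close>

definition choice_row :: "('n::finite, 'e) pre_digraph \<Rightarrow> 'n \<Rightarrow> 'n \<Rightarrow> 'e option \<Rightarrow> real^'n" where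
  "choice_row D k i a = (case a of None \<Rightarrow> axis k 1
     | Some e \<Rightarrow> if tail D e = i then axis i 1 - axis (head D e) 1 else 0)"

lemma laplacian_row:
  assumes "finite (arcs D)"
  shows "laplacian D $ i + axis k 1 = sum (choice_row D k i) (insert None (Some ` arcs D))"
proof -
  have "(\<Sum>e\<in>arcs D. choice_row D k i (Some e)) $ j = laplacian D $ i $ j" for j
  proof -
    have "(\<Sum>e\<in>arcs D. choice_row D k i (Some e)) $ j =
        (\<Sum>e\<in>arcs D. if tail D e = i then (if i = j then 1 else 0) - (if head D e = j then 1 else 0) else 0)"
      by (auto simp: choice_row_def axis_def intro!: sum.cong)
    also have "\<dots> = (\<Sum>e\<in>out_arcs D i. (if i = j then 1 else 0) - (if head D e = j then 1 else 0))"
      unfolding out_arcs_def using assms by (rule sum.inter_filter[symmetric])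
    also have "\<dots> = (if i = j then real (card (out_arcs D i)) else 0) - real (card {e \<in> out_arcs D i. head D e = j})"
      using assms by (simp add: sum_subtractf out_arcs_def flip: sum.inter_filter)
    also have "{e \<in> out_arcs D i. head D e = j} = {e \<in> arcs D. tail D e = i \<and> head D e = j}"
      by (auto simp: out_arcs_def)
    finally show ?thesis
      by (simp add: laplacian_def outdegree_matrix_def adjacency_matrix_def out_degree_def)
  qed
  then have "(\<Sum>e\<in>arcs D. choice_row D k i (Some e)) = laplacian D $ i"
    by (simp add: vec_eq_iff)
  moreover have "choice_row D k i None = axis k 1"
    by (simp add: choice_row_def)
  ultimately show ?thesis
    using assms by (simp add: sum.reindex image_iff add.commute)
qed

lemma det_choice_rows:
  assumes "\<And>i. c i \<in> insert None (Some ` arcs D)"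
  shows "det (\<chi> i. choice_row D k i (c i)) = (if c \<in> tree_choices D then 1 else 0)"
proof -
  let ?A = "\<chi> i. choice_row D k i (c i)"
  have row: "row i ?A = choice_row D k i (c i)" for i
    by (simp add: row_def vec_eq_iff)
  consider (tail) i e where "c i = Some e" "tail D e \<noteq> i"
    | (no_root) "\<And>i. c i \<noteq> None"
    | (two_roots) r s where "r \<noteq> s" "c r = None" "c s = None"
    | (root) r where "c r = None" "\<And>i. i \<noteq> r \<Longrightarrow> \<exists>e\<in>arcs D. c i = Some e \<and> tail D e = i"
  proof (cases "\<exists>i e. c i = Some e \<and> tail D e \<noteq> i")
    case False
    then have arc: "\<exists>e\<in>arcs D. c i = Some e \<and> tail D e = i" if "c i \<noteq> None" for i
      using that assms[of i] by auto
    show thesis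
    proof (cases "\<exists>r. c r = None")
      case True
      then obtain r where "c r = None" ..
      then show thesis
        using two_roots[of r] root[of r] arc by metis
    qed (rule no_root, simp)
  qed (use tail in blast)
  then show ?thesis
  proof cases
    case tail
    then have "row i ?A = 0"
      unfolding row by (simp add: choice_row_def)
    then have "det ?A = 0" by (rule det_zero_row)
    moreover have "c \<notin> tree_choices D"
      using tail unfolding tree_choices_def mem_Collect_eq
      by (metis option.distinct(1) option.inject)
    ultimately show ?thesis by simp
  next
    case no_root
    then have "\<exists>e. c i = Some e" for i by auto
    \<comment> \<open>Without a root every row is zero or a difference of two unit vectors, so the
      all-ones vector is in the kernel.\<close>
    then have "?A *v 1 = 0"
      by (auto simp: vec_eq_iff matrix_vector_mult_def choice_row_def axis_def sum_subtractf
          split: option.split)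
    then have "det ?A = 0"
      by (rule det_eq_0_if_kernel) simp
    with no_root show ?thesis by (auto simp: tree_choices_def)
  next
    case two_roots
    then have "det ?A = 0"
      by (intro det_identical_rows[of r s]) (simp_all only: row, simp_all add: choice_row_def)
    moreover have "c \<notin> tree_choices D"
      using two_roots by (auto simp: tree_choices_def) (metis option.distinct(1))
    ultimately show ?thesis by simp
  next
    case root
    let ?f = "\<lambda>i. head D (the (c i))"
    have "choice_row D k i (c i) = functional_matrix k r ?f $ i" for i
      using root(1) root(2)[of i] by (cases "i = r") (auto simp: choice_row_def functional_matrix_def)
    then have "?A = functional_matrix k r ?f"
      by (simp add: vec_eq_iff)
    moreover have "c \<in> tree_choices D \<longleftrightarrow> (\<forall>i. (i, r) \<in> (next_arc r ?f)\<^sup>*)"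
      using root unfolding tree_choices_def by (auto; metis option.distinct(1))
    ultimately show ?thesis by (simp add: det_functional_matrix)
  qed
qed

text \<open>Multilinearity in all rows at once: in the Leibniz formula each product of sums expands
  over the choice functions, and the two sums are exchanged.\<close>

lemma det_sum_rows:
  fixes a :: "'n::finite \<Rightarrow> 'b \<Rightarrow> 'a::comm_ring_1^'n"
  assumes "finite S"
  shows "det (\<chi> i. sum (a i) S) = (\<Sum>c\<in>UNIV \<rightarrow>\<^sub>E S. det (\<chi> i. a i (c i)))"
proof -
  have "det (\<chi> i. sum (a i) S) =
      (\<Sum>p | p permutes (UNIV :: 'n set). \<Sum>c\<in>UNIV \<rightarrow>\<^sub>E S. of_int (sign p) * (\<Prod>i\<in>UNIV. a i (c i) $ p i))"
    using assms by (simp add: det_def prod_sum_PiE sum_distrib_left)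
  also have "\<dots> = (\<Sum>c\<in>UNIV \<rightarrow>\<^sub>E S. det (\<chi> i. a i (c i)))"
    by (subst sum.swap) (simp add: det_def)
  finally show ?thesis .
qed

lemma det_laplacian_plus_axis:
  fixes D :: "('n::finite, 'e) pre_digraph"
  assumes "finite (arcs D)"
  shows "det (\<chi> i. laplacian D $ i + axis k 1) = real (card (tree_choices D))"
proof -
  let ?O = "insert None (Some ` arcs D)"
  let ?C = "(UNIV :: 'n set) \<rightarrow>\<^sub>E ?O"
  have O: "finite ?O" using assms by simp
  then have fin: "finite ?C"
    by (intro finite_PiE) auto
  have sub: "tree_choices D \<subseteq> ?C"
    by (auto simp: tree_choices_def PiE_UNIV_domain) (metis imageI)
  have "det (\<chi> i. laplacian D $ i + axis k 1) = (\<Sum>c\<in>?C. det (\<chi> i. choice_row D k i (c i)))"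
    by (simp only: laplacian_row[OF assms] det_sum_rows[OF O])
  also have "\<dots> = (\<Sum>c\<in>?C. if c \<in> tree_choices D then 1 else 0)"
    by (intro sum.cong refl det_choice_rows) blast
  also have "\<dots> = real (card (?C \<inter> tree_choices D))"
    using fin by (simp flip: sum.inter_restrict)
  also have "?C \<inter> tree_choices D = tree_choices D"
    using sub by blast
  finally show ?thesis .
qed

section \<open>Bijection between tree choices and spanning converging trees\<close>

definition choice_subgraph :: "('n, 'e) pre_digraph \<Rightarrow> ('n \<Rightarrow> 'e option) \<Rightarrow> ('n, 'e) pre_digraph" where
  "choice_subgraph D c = D\<lparr>arcs := {e \<in> arcs D. c (tail D e) = Some e}\<rparr>"

text \<open>Since every element of the type is a vertex, reachability inside the graph becomes plain
  \<open>rtrancl\<close>, with its usual induction rules.\<close>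

lemma connected_iff_rtrancl:
  fixes T :: "('n::finite, 'e) pre_digraph"
  assumes "verts T = UNIV"
  shows "Digraph_Component.connected T \<longleftrightarrow>
    (\<forall>u v. (u, v) \<in> (\<Union>e\<in>arcs T. {(tail T e, head T e), (head T e, tail T e)})\<^sup>*)"
proof -
  have "rtrancl_on UNIV R = R\<^sup>*" for R :: "'n rel"
    using rtrancl_consistent_rtrancl_on[of _ _ R UNIV] rtrancl_on_rtranclI[of _ _ UNIV R] by auto
  then show ?thesis
    using assms
    by (simp add: Digraph_Component.connected_def strongly_connected_def reachable_def
        parcs_mk_symmetric)
qed

text \<open>The choice at \<open>i\<close> is read off as the only retained arc with tail
  \<open>i\<close>, or \<open>None\<close> if there is no such arc.\<close>

lemma inj_on_choice_subgraph: "inj_on (choice_subgraph D) (tree_choices D)"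
proof (rule inj_onI)
  fix c d assume c: "c \<in> tree_choices D" and d: "d \<in> tree_choices D"
    and eq: "choice_subgraph D c = choice_subgraph D d"
  have choice: "c i = Some e \<longleftrightarrow> tail D e = i \<and> e \<in> arcs (choice_subgraph D c)"
    if "c \<in> tree_choices D" for c i e
    using that by (auto simp: tree_choices_def choice_subgraph_def)
      (metis option.distinct(1) option.inject)+
  show "c = d"
    using choice[OF c] choice[OF d] unfolding eq by (metis ext not_None_eq)
qed

context multi_digraph begin

lemma converging_tree_choice_subgraph:
  assumes "c \<in> tree_choices D"
  shows "spanning (choice_subgraph D c) D \<and> converging_tree (choice_subgraph D c)"
proof -
  let ?T = "choice_subgraph D c"
  obtain r where r: "c r = None" "\<And>i. i \<noteq> r \<Longrightarrow> \<exists>e\<in>arcs D. c i = Some e \<and> tail D e = i"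
    "\<And>i. (i, r) \<in> (next_arc r (\<lambda>i. head D (the (c i))))\<^sup>*"
    using assms by (auto simp: tree_choices_def)
  have T: "verts ?T = UNIV" "tail ?T = tail D" "head ?T = head D"
    "arcs ?T = {e \<in> arcs D. c (tail D e) = Some e}"
    by (simp_all add: choice_subgraph_def verts_UNIV)
  have fin: "fin_digraph ?T"
    by unfold_locales (auto simp: T)
  have loopfree: "loopfree_digraph ?T"
    using fin no_loops by (auto simp: T loopfree_digraph_def loopfree_digraph_axioms_def fin_digraph_def)
  have "subgraph ?T D"
    using fin by (auto simp: subgraph_def T verts_UNIV compatible_def fin_digraph_def intro: wf_digraph_axioms)
  then have span: "spanning ?T D"
    by (simp add: spanning_def T verts_UNIV)
  let ?E = "\<Union>e\<in>arcs ?T. {(tail ?T e, head ?T e), (head ?T e, tail ?T e)}"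
  have "next_arc r (\<lambda>i. head D (the (c i))) \<subseteq> ?E"
    using r(2) by (fastforce simp: next_arc_def T)
  then have "(i, r) \<in> ?E\<^sup>*" for i
    using r(3)[of i] rtrancl_mono by blast
  \<comment> \<open>Symmetry turns paths to \<open>r\<close> into paths from \<open>r\<close>, so
    any two vertices are joined through \<open>r\<close>.\<close>
  moreover have "sym (?E\<^sup>*)"
    by (intro sym_rtrancl) (auto simp: sym_def)
  ultimately have "(i, j) \<in> ?E\<^sup>*" for i j
    by (meson rtrancl_trans symD)
  then have conn: "Digraph_Component.connected ?T"
    by (simp only: connected_iff_rtrancl[OF T(1)]) blast
  have "out_arcs ?T r = {}"
    using r(1) by (auto simp: out_arcs_def T)
  moreover have "\<exists>e. out_arcs ?T i = {e}" if "i \<noteq> r" for i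
    using r(2)[OF that] by (auto simp: out_arcs_def T)
  ultimately have "out_degree ?T r = 0" "\<And>i. i \<noteq> r \<Longrightarrow> out_degree ?T i = 1"
    by (simp_all add: out_degree_def) (metis card_1_singleton_iff One_nat_def)
  with span fin loopfree conn show ?thesis
    by (auto simp: converging_tree_def T)
qed

text \<open>The root chooses \<open>None\<close> and any other vertex its unique outgoing arc.
  Connectedness gives only undirected paths from \<open>r\<close>; induction along them shows that
  each vertex has a directed path to \<open>r\<close>.\<close>

lemma choice_of_converging_tree:
  assumes "spanning T D" "converging_tree T"
  shows "T \<in> choice_subgraph D ` tree_choices D"
proof -
  have T: "verts T = UNIV" "tail T = tail D" "head T = head D" "arcs T \<subseteq> arcs D"
    using assms(1) by (auto simp: spanning_def subgraph_def compatible_def verts_UNIV)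
  obtain r where fin: "fin_digraph T" and conn: "Digraph_Component.connected T"
    and r: "out_degree T r = 0" "\<And>v. v \<noteq> r \<Longrightarrow> out_degree T v = 1"
    using assms(2) by (auto simp: converging_tree_def T)
  have out_r: "out_arcs T r = {}"
    using r(1) fin_digraph.finite_out_arcs[OF fin, of r] by (simp add: out_degree_def)
  have "\<forall>v. \<exists>e. v \<noteq> r \<longrightarrow> out_arcs T v = {e}"
    using r(2) by (metis out_degree_def card_1_singletonE)
  then obtain g where g: "\<And>v. v \<noteq> r \<Longrightarrow> out_arcs T v = {g v}"
    by metis
  define c where "c v = (if v = r then None else Some (g v))" for v
  have g': "g v \<in> arcs T" "tail D (g v) = v" if "v \<noteq> r" for v
    using g[OF that] by (auto simp: out_arcs_def T)
  have arc: "tail D e \<noteq> r \<and> g (tail D e) = e" if "e \<in> arcs T" for e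
  proof -
    have "e \<in> out_arcs T (tail D e)"
      using that by (simp add: out_arcs_def T)
    with out_r g[of "tail D e"] show ?thesis by (cases "tail D e = r") auto
  qed
  let ?N = "next_arc r (\<lambda>i. head D (the (c i)))"
  let ?E = "\<Union>e\<in>arcs T. {(tail T e, head T e), (head T e, tail T e)}"
  have N: "(tail D e, head D e) \<in> ?N" if "e \<in> arcs T" for e
    using arc[OF that] by (auto simp: next_arc_def c_def)
  have "(i, r) \<in> ?N\<^sup>*" for i
  proof -
    have "(r, i) \<in> ?E\<^sup>*"
      using conn by (simp only: connected_iff_rtrancl[OF T(1)])
    then show ?thesis
    proof induction
      case (step x y)
      then obtain e where e: "e \<in> arcs T"
        "(x, y) = (tail D e, head D e) \<or> (x, y) = (head D e, tail D e)"
        by (auto simp: T)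
      then show ?case
      proof (elim disjE)
        \<comment> \<open>The arc runs from \<open>y\<close> to \<open>x\<close> and is prepended to
          the path from \<open>x\<close>.\<close>
        assume "(x, y) = (head D e, tail D e)"
        then show ?thesis using N[OF e(1)] step.IH by (auto intro: converse_rtrancl_into_rtrancl)
      next
        \<comment> \<open>The arc runs from \<open>x\<close> to \<open>y\<close>. It is the only one
          leaving \<open>x\<close>, so the path from \<open>x\<close> to \<open>r\<close> passes
          through \<open>y\<close>.\<close>
        assume xy: "(x, y) = (tail D e, head D e)"
        with arc[OF e(1)] have x: "x \<noteq> r" "y = head D (the (c x))" by (auto simp: c_def)
        from step.IH show ?thesis
          using x by (cases rule: converse_rtranclE) (auto simp: next_arc_def)
      qed
    qed simp
  qed
  then have "c \<in> tree_choices D"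
    using g' T(4) by (auto simp: tree_choices_def c_def intro!: exI[of _ r])
  moreover have "T = choice_subgraph D c"
  proof -
    have "arcs T = {e \<in> arcs D. c (tail D e) = Some e}"
      using arc g' T(4) by (auto simp: c_def split: if_splits) (metis g'(1))
    then show ?thesis
      using T by (simp add: choice_subgraph_def verts_UNIV)
  qed
  ultimately show ?thesis by blast
qed

lemma complexity_eq_card_tree_choices: "complexity D = card (tree_choices D)"
proof -
  have "{T. spanning T D \<and> converging_tree T} = choice_subgraph D ` tree_choices D"
    using converging_tree_choice_subgraph choice_of_converging_tree by blast
  then show ?thesis
    by (simp add: complexity_def card_image inj_on_choice_subgraph)
qed

end

section \<open>Transvections\<close>

text \<open>The matrix is \<open>mat 1\<close> with a combination of the other rows added to row
  \<open>k\<close>.\<close>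

lemma det_row_transvection:
  fixes u :: "'n::finite \<Rightarrow> 'a::field"
  shows "det ((\<chi> i j. if i = j then 1 else if i = k then u j else 0) :: 'a^'n^'n) = 1"
proof -
  define x :: "'a^'n" where "x = (\<Sum>j\<in>-{k}. u j *s axis j 1)"
  have "row j (mat 1 :: 'a^'n^'n) = axis j 1" for j
    by (simp add: row_def mat_def axis_def vec_eq_iff eq_commute)
  then have "x \<in> vec.span {row j (mat 1 :: 'a^'n^'n) |j. j \<noteq> k}"
    unfolding x_def by (intro vec.span_sum vec.span_scale vec.span_base) auto
  then have "det (\<chi> i. if i = k then row k (mat 1) + x else row i (mat 1)) = (1 :: 'a)"
    by (simp add: det_row_span)
  moreover have "x $ j = (if j = k then 0 else u j)" for j
    by (simp add: x_def axis_def if_distrib[of "\<lambda>y. _ * y"] sum.delta' cong: if_cong)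
  then have "(\<chi> i. if i = k then row k (mat 1) + x else row i (mat 1)) =
      ((\<chi> i j. if i = j then 1 else if i = k then u j else 0) :: 'a^'n^'n)"
    by (auto simp: vec_eq_iff row_def mat_def)
  ultimately show ?thesis by simp
qed

lemma det_column_transvection:
  fixes u :: "'n::finite \<Rightarrow> 'a::field"
  shows "det ((\<chi> i j. if i = j then 1 else if j = k then u i else 0) :: 'a^'n^'n) = 1"
proof -
  let ?R = "(\<chi> i j. if i = j then 1 else if i = k then u j else 0) :: 'a^'n^'n"
  have "(\<chi> i j. if i = j then 1 else if j = k then u i else 0) = transpose ?R"
    by (auto simp: transpose_def vec_eq_iff)
  then show ?thesis
    by (simp only: det_transpose det_row_transvection)
qed

text \<open>Holds the edge vectors from vertex \<open>k\<close> to the other vertices, without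
  coordinate \<open>k\<close>. Padding with row and column \<open>k\<close> of the identity keeps
  the matrix square over the same index type and leaves the determinant of the smaller matrix
  unchanged.\<close>

definition edge_matrix :: "'n::finite \<Rightarrow> real^'n^'n \<Rightarrow> real^'n^'n" where
  "edge_matrix k A = (\<chi> i j. if i = k \<or> j = k then if i = j then 1 else 0 else A $ i $ j - A $ k $ j)"

text \<open>Unimodular operations: \<open>?F\<close> adds all columns to column \<open>k\<close>,
  which becomes constantly 1 because the rows of \<open>A\<close> sum to 0; \<open>?E\<close>
  subtracts row \<open>k\<close> from the others; on the other side \<open>?G\<close> restores row
  \<open>k\<close> of \<open>A\<close> in the padding row.\<close>

lemma det_edge_matrix:
  assumes "\<And>i. (\<Sum>j\<in>UNIV. A $ i $ j) = 0"
  shows "det (edge_matrix k A) = det (\<chi> i. A $ i + axis k 1)"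
proof -
  let ?M = "(\<chi> i. A $ i + axis k 1) :: real^'a^'a"
  let ?E = "(\<chi> i j. if i = j then 1 else if j = k then - 1 else 0) :: real^'a^'a"
  let ?F = "(\<chi> i j. if i = j then 1 else if j = k then 1 else 0) :: real^'a^'a"
  let ?G = "(\<chi> i j. if i = j then 1 else if i = k then A $ k $ j else 0) :: real^'a^'a"
  have split: "sum f UNIV = f k + sum f (- {k})" for f :: "'a \<Rightarrow> real"
    by (simp add: sum.remove[of UNIV k] Compl_eq_Diff_UNIV)
  have row_sum: "A $ i $ k + (\<Sum>j\<in>-{k}. A $ i $ j) = 0" for i
    using assms[of i] by (simp only: split)
  note ifs = if_distrib[of "\<lambda>y. y * _"] if_distrib[of "\<lambda>y. _ * y"]
  have MF: "(?M ** ?F) $ i $ j = (if j = k then 1 else A $ i $ j)" for i j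
    using row_sum[of i] by (simp add: matrix_matrix_mult_def split axis_def ifs sum.delta sum.delta' cong: if_cong sum.cong_simp)
  have EN: "(?E ** N) $ i $ j = (if i = k then N $ k $ j else N $ i $ j - N $ k $ j)"
    for i j and N :: "real^'a^'a"
    by (simp add: matrix_matrix_mult_def split ifs sum.delta sum.delta' cong: if_cong sum.cong_simp)
  have BG: "(edge_matrix k A ** ?G) $ i $ j =
      (if i = k then if j = k then 1 else A $ k $ j
       else if j = k then 0 else A $ i $ j - A $ k $ j)" for i j
    by (simp add: matrix_matrix_mult_def edge_matrix_def split ifs sum.delta sum.delta' cong: if_cong sum.cong_simp)
  have "?E ** (?M ** ?F) = edge_matrix k A ** ?G"
    by (simp add: vec_eq_iff MF EN BG)
  from arg_cong[OF this, of det]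
  have "det ?E * (det ?M * det ?F) = det (edge_matrix k A) * det ?G"
    by (simp only: det_mul)
  moreover have "det ?E = 1" "det ?F = 1"
    by (rule det_column_transvection)+
  moreover have "det ?G = 1"
    by (rule det_row_transvection)
  ultimately show ?thesis
    by (simp only: mult_1 mult_1_right)
qed

section \<open>Volume of a projected simplex\<close>

lemma measure_shear_cbox:
  fixes a b :: "real^'n::finite"
  assumes "m \<noteq> n"
  defines "h \<equiv> \<lambda>v::real^'n. \<chi> i. if i = m then v $ m + v $ n else v $ i"
  shows "measure lebesgue (h ` cbox a b) = measure lebesgue (cbox a b)"
proof (cases "cbox a b = {}")
  case False
  \<comment> \<open>Translating by \<open>t\<close> makes coordinate \<open>n\<close> of the lower
    corner 0, a position covered by \<open>measure_shear_interval\<close>.\<close>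
  define t :: "real^'n" where "t = axis n (- a $ n)"
  have shift: "cbox a b = (+) (- t) ` cbox (t + a) (t + b)"
    by (simp add: cbox_translation image_image)
  have "h (- t + x) = h (- t) + h x" for x
    by (simp add: h_def vec_eq_iff)
  then have "h ` cbox a b = (+) (h (- t)) ` h ` cbox (t + a) (t + b)"
    by (simp add: shift image_image)
  moreover have "measure lebesgue (h ` cbox (t + a) (t + b)) = measure lebesgue (cbox (t + a) (t + b))"
    unfolding h_def using \<open>m \<noteq> n\<close> False
    by (intro measure_shear_interval) (auto simp: cbox_translation t_def axis_def)
  ultimately show ?thesis
    by (simp only: measure_translation shift)
qed simp

text \<open>The image is again a box, with two side lengths exchanged.\<close>

lemma measure_swap_cbox:
  fixes a b :: "real^'n::finite" and m n :: 'n
  defines "h \<equiv> \<lambda>v::real^'n. \<chi> i. v $ Transposition.transpose m n i"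
  shows "measure lebesgue (h ` cbox a b) = measure lebesgue (cbox a b)"
proof (cases "cbox a b = {}")
  case False
  have h: "h (h x) = x" for x
    by (simp add: h_def vec_eq_iff)
  have "h x \<in> cbox (h a) (h b) \<longleftrightarrow> x \<in> cbox a b" for x
    unfolding mem_box_cart h_def vec_lambda_beta by (metis transpose_involutory)
  then have eq: "h ` cbox a b = cbox (h a) (h b)"
    by (auto simp: image_iff) (metis h)
  have "cbox (h a) (h b) \<noteq> {}"
    using False eq by blast
  then have "measure lebesgue (cbox (h a) (h b)) = (\<Prod>i\<in>UNIV. h b $ i - h a $ i)"
    by (simp add: content_cbox_cart)
  also have "\<dots> = (\<Prod>i\<in>UNIV. b $ i - a $ i)"
    using prod.permute[OF permutes_swap_id[of m UNIV n], of "\<lambda>i. b $ i - a $ i"]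
    by (simp add: h_def o_def)
  also have "\<dots> = measure lebesgue (cbox a b)"
    using False by (simp add: content_cbox_cart)
  finally show ?thesis by (simp add: eq)
qed simp

text \<open>
  The library has this only for index types of class \<open>wellorder\<close>, through its computation of the
  determinant of a shear as a triangular determinant.
\<close>

lemma measure_linear_image_finite:
  fixes f :: "real^'n::finite \<Rightarrow> real^'n"
  assumes "linear f" "S \<in> lmeasurable"
  shows "f ` S \<in> lmeasurable \<and> measure lebesgue (f ` S) = \<bar>det (matrix f)\<bar> * measure lebesgue S"
proof -
  have box: "h ` S \<in> lmeasurable \<and> measure lebesgue (h ` S) = \<bar>det (matrix h)\<bar> * measure lebesgue S"
    if "linear h" "\<bar>det (matrix h)\<bar> = 1" "S \<in> lmeasurable"
      "\<And>a b. measure lebesgue (h ` cbox a b) = measure lebesgue (cbox a b)"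
    for h :: "real^'n \<Rightarrow> real^'n" and S
    using measure_linear_sufficient[of h S 1] that by simp
  have "\<forall>S\<in>lmeasurable. f ` S \<in> lmeasurable \<and> measure lebesgue (f ` S) = \<bar>det (matrix f)\<bar> * measure lebesgue S"
  \<comment> \<open>Every linear map is composed of maps with a vanishing coordinate, coordinate
    scalings, transpositions and shears. For the last two, \<open>box\<close> reduces the claim to
    boxes.\<close>
  proof (rule induct_linear_elementary[OF \<open>linear f\<close>]; intro ballI)
    fix f g :: "real^'n \<Rightarrow> real^'n" and S :: "(real^'n) set"
    assume "linear f" "linear g" "S \<in> lmeasurable"
      and "\<forall>S\<in>lmeasurable. f ` S \<in> lmeasurable \<and> measure lebesgue (f ` S) = \<bar>det (matrix f)\<bar> * measure lebesgue S"
      and "\<forall>S\<in>lmeasurable. g ` S \<in> lmeasurable \<and> measure lebesgue (g ` S) = \<bar>det (matrix g)\<bar> * measure lebesgue S"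
    then show "(f \<circ> g) ` S \<in> lmeasurable \<and>
        measure lebesgue ((f \<circ> g) ` S) = \<bar>det (matrix (f \<circ> g))\<bar> * measure lebesgue S"
      unfolding image_comp[symmetric] by (simp add: matrix_compose det_mul abs_mult)
  next
    fix f :: "real^'n \<Rightarrow> real^'n" and i and S :: "(real^'n) set"
    assume f: "linear f" "\<And>x. f x $ i = 0"
    \<comment> \<open>The map misses every vector with nonzero coordinate \<open>i\<close>, so it is
      singular and both sides vanish.\<close>
    then have "\<not> inj f"
      by (metis (full_types) linear_injective_imp_surjective one_neq_zero surjE vec_component)
    then have "negligible (f ` S)" "det (matrix f) = 0"
      using f(1) negligible_linear_singular_image det_nz_iff_inj by blast+
    then show "f ` S \<in> lmeasurable \<and> measure lebesgue (f ` S) = \<bar>det (matrix f)\<bar> * measure lebesgue S"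
      by (simp add: negligible_iff_measure)
  next
    fix c :: "'n \<Rightarrow> real" and S :: "(real^'n) set"
    assume S: "S \<in> lmeasurable"
    have "det (matrix (\<lambda>x::real^'n. \<chi> i. c i * x $ i)) = prod c UNIV"
      by (simp add: det_diagonal matrix_def axis_def)
    then show "(\<lambda>x. \<chi> i. c i * x $ i) ` S \<in> lmeasurable \<and>
        measure lebesgue ((\<lambda>x. \<chi> i. c i * x $ i) ` S) =
        \<bar>det (matrix (\<lambda>x. \<chi> i. c i * x $ i))\<bar> * measure lebesgue S"
      using measurable_stretch[OF S] measure_stretch[OF S] by simp
  next
    fix m n :: 'n and S :: "(real^'n) set"
    assume S: "S \<in> lmeasurable"
    let ?h = "\<lambda>v::real^'n. \<chi> i. v $ Transposition.transpose m n i"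
    have "matrix ?h = (\<chi> i. mat 1 $ Transposition.transpose m n i)"
      by (simp add: matrix_def axis_def mat_def vec_eq_iff)
    then have "\<bar>det (matrix ?h)\<bar> = 1"
      by (simp add: det_permute_rows permutes_swap_id sign_swap_id abs_mult)
    moreover have "linear ?h"
      by (rule linearI) (simp_all add: vec_eq_iff)
    ultimately show "?h ` S \<in> lmeasurable \<and> measure lebesgue (?h ` S) = \<bar>det (matrix ?h)\<bar> * measure lebesgue S"
      using S by (intro box measure_swap_cbox)
  next
    fix m n :: 'n and S :: "(real^'n) set"
    assume mn: "m \<noteq> n" and S: "S \<in> lmeasurable"
    let ?h = "\<lambda>v::real^'n. \<chi> i. if i = m then v $ m + v $ n else v $ i"
    have "matrix ?h = (\<chi> i j. if i = j then 1 else if i = m then if j = n then 1 else 0 else 0)"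
      using mn by (auto simp: matrix_def axis_def vec_eq_iff)
    then have "\<bar>det (matrix ?h)\<bar> = 1"
      by (simp only: det_row_transvection abs_one)
    moreover have "linear ?h"
      by (rule linearI) (simp_all add: vec_eq_iff algebra_simps)
    ultimately show "?h ` S \<in> lmeasurable \<and> measure lebesgue (?h ` S) = \<bar>det (matrix ?h)\<bar> * measure lebesgue S"
      using S mn by (intro box measure_shear_cbox)
  qed
  with assms(2) show ?thesis by blast
qed

section \<open>Product measure and Lebesgue measure\<close>

lemma measurable_vec_lambda:
  "(vec_lambda :: ('n::finite \<Rightarrow> real) \<Rightarrow> real^'n) \<in> (\<Pi>\<^sub>M i\<in>UNIV. lborel) \<rightarrow>\<^sub>M borel"
proof -
  have eq: "(vec_lambda :: ('n \<Rightarrow> real) \<Rightarrow> real^'n) = (\<lambda>f. \<Sum>i\<in>UNIV. f i *\<^sub>R axis i 1)"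
    by (auto simp: fun_eq_iff vec_eq_iff axis_def if_distrib[of "\<lambda>y. _ * y"] sum.delta cong: if_cong)
  show ?thesis unfolding eq by measurable
qed

text \<open>\<open>lborel\<close> is determined by its values on boxes, which are products of side
  lengths on both sides.\<close>

lemma lborel_vec_eq:
  "(lborel :: (real^'n::finite) measure) = distr (\<Pi>\<^sub>M i\<in>UNIV. lborel) borel vec_lambda"
proof (rule lborel_eqI)
  fix l u :: "real^'n" assume le: "\<And>b. b \<in> Basis \<Longrightarrow> l \<bullet> b \<le> u \<bullet> b"
  interpret product_sigma_finite "\<lambda>_::'n. (lborel :: real measure)" by standard
  have le': "l $ i \<le> u $ i" for i
    using le[of "axis i 1"] by (simp add: inner_axis Basis_vec_def) blast
  have "vec_lambda -` box l u \<inter> space (\<Pi>\<^sub>M i\<in>(UNIV::'n set). lborel) =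
      (\<Pi>\<^sub>E i\<in>UNIV. {l $ i <..< u $ i})"
    by (auto simp: mem_box_cart space_PiM PiE_iff)
  then have "emeasure (distr (\<Pi>\<^sub>M i\<in>UNIV. lborel) borel vec_lambda) (box l u) =
      (\<Prod>i\<in>UNIV. emeasure lborel {l $ i <..< u $ i})"
    by (simp add: emeasure_distr[OF measurable_vec_lambda] emeasure_PiM)
  also have "\<dots> = ennreal (\<Prod>i\<in>UNIV. u $ i - l $ i)"
    using le' by (simp add: prod_ennreal)
  also have "(\<Prod>i\<in>UNIV. u $ i - l $ i) = (\<Prod>b\<in>Basis. (u - l) \<bullet> b)"
    by (simp add: Basis_vec_def UNION_singleton_eq_range prod.reindex axis_eq_axis inj_on_def inner_axis)
  finally show "emeasure (distr (\<Pi>\<^sub>M i\<in>UNIV. lborel) borel vec_lambda) (box l u) =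
      ennreal (\<Prod>b\<in>Basis. (u - l) \<bullet> b)" .
qed simp

text \<open>
  Thickening a set of extensional functions by the unit interval in coordinate \<open>k\<close> keeps its measure
  and moves it to \<open>real^'n\<close>, where the change of variables for linear maps is available.
\<close>

definition prism :: "'n::finite \<Rightarrow> ('n \<Rightarrow> real) set \<Rightarrow> (real^'n) set" where
  "prism k S = {y. 0 \<le> y $ k \<and> y $ k \<le> 1 \<and> delete_coordinate k y \<in> S}"

lemma measurable_delete_coordinate [measurable]:
  "delete_coordinate k \<in> borel \<rightarrow>\<^sub>M (\<Pi>\<^sub>M i\<in>-{k}. lborel)"
  unfolding delete_coordinate_def[abs_def] by (intro measurable_restrict) simp

lemma sets_prism [measurable]:
  assumes [measurable]: "S \<in> sets (\<Pi>\<^sub>M i\<in>-{k}. lborel)"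
  shows "prism k S \<in> sets borel"
  unfolding prism_def by measurable

text \<open>Integrating over coordinate \<open>k\<close> first contributes the length 1 of the unit
  interval.\<close>

lemma emeasure_prism:
  assumes S: "S \<in> sets (\<Pi>\<^sub>M i\<in>-{k}. lborel)"
  shows "emeasure lborel (prism k S) = emeasure (\<Pi>\<^sub>M i\<in>-{k}. lborel) S"
proof -
  interpret product_sigma_finite "\<lambda>_::'a. (lborel :: real measure)" by standard
  let ?X = "vec_lambda -` prism k S \<inter> space (\<Pi>\<^sub>M i\<in>(UNIV::'a set). lborel)"
  have ins: "insert k (- {k}) = (UNIV :: 'a set)" by auto
  have X: "?X \<in> sets (\<Pi>\<^sub>M i\<in>insert k (- {k}). lborel)"
    unfolding ins using measurable_vec_lambda sets_prism[OF S] by (rule measurable_sets)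
  have "emeasure lborel (prism k S) = emeasure (\<Pi>\<^sub>M i\<in>UNIV. lborel) ?X"
    unfolding lborel_vec_eq using measurable_vec_lambda sets_prism[OF S] by (rule emeasure_distr)
  also have "\<dots> = (\<integral>\<^sup>+ f. indicator ?X f \<partial>(\<Pi>\<^sub>M i\<in>insert k (- {k}). lborel))"
    using X unfolding ins by (simp add: nn_integral_indicator)
  also have "\<dots> = (\<integral>\<^sup>+ x. \<integral>\<^sup>+ y. indicator ?X (x(k := y)) \<partial>lborel \<partial>(\<Pi>\<^sub>M i\<in>-{k}. lborel))"
    using X by (intro product_nn_integral_insert) auto
  also have "\<dots> = (\<integral>\<^sup>+ x. indicator S x \<partial>(\<Pi>\<^sub>M i\<in>-{k}. lborel))"
  proof (rule nn_integral_cong)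
    fix x :: "'a \<Rightarrow> real" assume "x \<in> space (\<Pi>\<^sub>M i\<in>-{k}. lborel)"
    then have "delete_coordinate k (vec_lambda (x(k := y))) = x" for y
      by (auto simp: delete_coordinate_def space_PiM PiE_def extensional_def fun_eq_iff)
    then have "indicator ?X (x(k := y)) = (indicator S x * indicator {0..1} y :: ennreal)" for y :: real
      by (auto simp: prism_def indicator_def space_PiM)
    then show "(\<integral>\<^sup>+ y. indicator ?X (x(k := y)) \<partial>lborel) = (indicator S x :: ennreal)"
      by (simp add: nn_integral_cmult)
  qed
  also have "\<dots> = emeasure (\<Pi>\<^sub>M i\<in>-{k}. lborel) S"
    using S by simp
  finally show ?thesis .
qed

section \<open>The polytope as an affine image of the standard simplex\<close>

lemma convex_hull_rows:
  fixes A :: "real^'n^'m::finite"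
  shows "convex hull (rows A) = {\<Sum>i\<in>UNIV. u i *\<^sub>R A $ i |u. (\<forall>i. 0 \<le> u i) \<and> sum u UNIV = 1}"
    (is "_ = ?R")
proof (rule antisym)
  show "convex hull (rows A) \<subseteq> ?R"
  proof (rule hull_minimal)
    show "rows A \<subseteq> ?R"
    proof
      fix x assume "x \<in> rows A"
      then obtain i where "x = A $ i" by (auto simp: rows_def row_def)
      \<comment> \<open>A point mass at one index of the row. Weights live on indices, so coinciding
        rows cause no conflict.\<close>
      then show "x \<in> ?R"
        by (auto intro!: exI[of _ "\<lambda>j. if j = i then 1 else 0"]
            simp: if_distrib[of "\<lambda>y. y *\<^sub>R _"] cong: if_cong)
    qed
    show "convex ?R"
      unfolding convex_def
    proof clarify
      fix a b :: real and u v :: "'m \<Rightarrow> real"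
      assume "0 \<le> a" "0 \<le> b" "a + b = 1" "\<forall>i. 0 \<le> u i" "sum u UNIV = 1" "\<forall>i. 0 \<le> v i" "sum v UNIV = 1"
      then show "\<exists>w. a *\<^sub>R (\<Sum>i\<in>UNIV. u i *\<^sub>R A $ i) + b *\<^sub>R (\<Sum>i\<in>UNIV. v i *\<^sub>R A $ i) =
          (\<Sum>i\<in>UNIV. w i *\<^sub>R A $ i) \<and> (\<forall>i. 0 \<le> w i) \<and> sum w UNIV = 1"
        by (intro exI[of _ "\<lambda>i. a * u i + b * v i"])
          (simp add: scaleR_sum_right sum.distrib scaleR_add_left flip: sum_distrib_left)
    qed
  qed
  show "?R \<subseteq> convex hull (rows A)"
  proof clarify
    fix u :: "'m \<Rightarrow> real" assume u: "\<forall>i. 0 \<le> u i" "sum u UNIV = 1"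
    have "A $ i \<in> rows A" for i
      by (auto simp: rows_def row_def vec_eq_iff intro!: exI[of _ i])
    then show "(\<Sum>i\<in>UNIV. u i *\<^sub>R A $ i) \<in> convex hull (rows A)"
      using u by (intro convex_sum) (auto intro: hull_inc)
  qed
qed

text \<open>Filling coordinate \<open>k\<close> with 0 sends the projection to a continuous image of
  \<open>P\<close>, which is compact and hence closed. The filling map is measurable and injective
  on extensional functions, so the preimage of this closed set is the projection itself.\<close>

lemma sets_delete_coordinate_compact:
  assumes "compact P"
  shows "delete_coordinate k ` P \<in> sets (\<Pi>\<^sub>M i\<in>-{k}. lborel)"
proof -
  let ?M = "\<Pi>\<^sub>M i\<in>-{k}. (lborel :: real measure)"
  let ?h = "\<lambda>x. (\<chi> i. if i = k then 0 else x i) :: real^'a"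
  have "?h = (\<lambda>x. \<Sum>i\<in>-{k}. x i *\<^sub>R axis i 1)"
    by (auto simp: fun_eq_iff vec_eq_iff axis_def if_distrib[of "\<lambda>y. _ * y"] sum.delta' cong: if_cong)
  then have h: "?h \<in> ?M \<rightarrow>\<^sub>M borel" by simp
  have "compact ((\<lambda>y. ?h (($) y)) ` P)"
  proof (intro compact_continuous_image continuous_on_vec_lambda)
    show "continuous_on P (\<lambda>y. if i = k then 0 else y $ i)" for i
      by (cases "i = k") (auto intro!: continuous_intros)
  qed (fact assms)
  then have "?h -` ((\<lambda>y. ?h (($) y)) ` P) \<inter> space ?M \<in> sets ?M"
    using h by (intro measurable_sets) (auto simp: compact_imp_closed)
  also have "?h -` ((\<lambda>y. ?h (($) y)) ` P) \<inter> space ?M = delete_coordinate k ` P"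
  proof -
    have "?h x = ?h (($) y) \<longleftrightarrow> x = delete_coordinate k y" if "x \<in> space ?M" for x y
      using that by (auto simp: vec_eq_iff fun_eq_iff delete_coordinate_def space_PiM PiE_def extensional_def)
    moreover have "delete_coordinate k y \<in> space ?M" for y
      by (auto simp: delete_coordinate_def space_PiM)
    ultimately show ?thesis by auto
  qed
  finally show ?thesis .
qed

text \<open>The intersection with the space keeps only extensional functions and matches
  \<open>emeasure_std_simplex_aux\<close>.\<close>

definition corner_simplex :: "'n::finite \<Rightarrow> ('n \<Rightarrow> real) set" where
  "corner_simplex k = {x. (\<forall>i\<in>-{k}. 0 \<le> x i) \<and> sum x (- {k}) \<le> 1} \<inter> space (\<Pi>\<^sub>M i\<in>-{k}. (lborel :: real measure))"

lemma sets_corner_simplex: "corner_simplex k \<in> sets (\<Pi>\<^sub>M i\<in>-{k}. lborel)"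
proof -
  have "corner_simplex k = (\<Pi>\<^sub>E i\<in>-{k}. {0..}) \<inter> ((\<lambda>x. sum x (- {k})) -` {..1} \<inter> space (\<Pi>\<^sub>M i\<in>-{k}. lborel))"
    by (auto simp: corner_simplex_def space_PiM)
  also have "\<dots> \<in> sets (\<Pi>\<^sub>M i\<in>-{k}. lborel)"
    by measurable
  finally show ?thesis .
qed

lemma emeasure_corner_simplex:
  "emeasure (\<Pi>\<^sub>M i\<in>-{k}. lborel) (corner_simplex k) = ennreal (1 / fact (card (- {k :: 'n::finite})))"
  unfolding corner_simplex_def using emeasure_std_simplex_aux[of "- {k}" 1] by simp

text \<open>Eliminating the barycentric weight of row \<open>k\<close> writes a point of the hull as
  A_k plus the sum of u_i (A_i - A_k), where the remaining weights range over the corner simplex.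
  The transpose appears because weights combine rows. The padding of \<open>edge_matrix\<close>
  carries the prism height in coordinate \<open>k\<close> along unchanged.\<close>

lemma prism_convex_hull_rows:
  fixes A :: "real^'n^'n" and k :: 'n
  shows "prism k (delete_coordinate k ` (convex hull (rows A))) =
    (+) (\<chi> j. if j = k then 0 else A $ k $ j) ` (*v) (transpose (edge_matrix k A)) ` prism k (corner_simplex k)"
    (is "?L = (+) ?t ` _ ` _")
proof -
  have split: "sum f UNIV = f k + sum f (- {k})" for f :: "'n \<Rightarrow> real"
    by (simp add: sum.remove[of UNIV k] Compl_eq_Diff_UNIV)
  let ?T = "\<lambda>x. ?t + transpose (edge_matrix k A) *v x"
  have T: "?T x $ j = (if j = k then x $ k else
      A $ k $ j * (1 - (\<Sum>i\<in>-{k}. x $ i)) + (\<Sum>i\<in>-{k}. x $ i * A $ i $ j))" for x j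
    by (auto simp: matrix_vector_mult_def transpose_def edge_matrix_def split left_diff_distrib
        right_diff_distrib sum_subtractf sum_distrib_left mult.commute)
  have mem: "x \<in> prism k (corner_simplex k) \<longleftrightarrow>
      0 \<le> x $ k \<and> x $ k \<le> 1 \<and> (\<forall>i\<in>-{k}. 0 \<le> x $ i) \<and> (\<Sum>i\<in>-{k}. x $ i) \<le> 1" for x :: "real^'n"
    by (auto simp: prism_def corner_simplex_def delete_coordinate_def space_PiM)
  have hull: "p \<in> convex hull (rows A) \<longleftrightarrow>
      (\<exists>u. (\<forall>i. 0 \<le> u i) \<and> sum u UNIV = 1 \<and> (\<forall>j. p $ j = (\<Sum>i\<in>UNIV. u i * A $ i $ j)))" for p
    by (auto simp: convex_hull_rows vec_eq_iff)
  have "?L = ?T ` prism k (corner_simplex k)"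
  proof (intro antisym subsetI)
    fix y assume "y \<in> ?L"
    then obtain p where y: "0 \<le> y $ k" "y $ k \<le> 1" and p: "p \<in> convex hull (rows A)"
        and yp: "delete_coordinate k y = delete_coordinate k p"
      by (auto simp: prism_def)
    from yp have yp: "y $ j = p $ j" if "j \<noteq> k" for j
      using that by (auto simp: delete_coordinate_def fun_eq_iff dest: spec[of _ j])
    from p obtain u where u: "\<forall>i. 0 \<le> u i" "sum u UNIV = 1" "\<And>j. p $ j = (\<Sum>i\<in>UNIV. u i * A $ i $ j)"
      by (auto simp: hull)
    have uk: "u k = 1 - (\<Sum>i\<in>-{k}. u i)"
      using u(2) by (simp add: split)
    \<comment> \<open>Slot \<open>k\<close> holds the height of \<open>y\<close>, the other slots
      the weights.\<close>
    let ?x = "(\<chi> i. if i = k then y $ k else u i) :: real^'n"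
    have "?x \<in> prism k (corner_simplex k)"
      using y u(1) uk by (simp add: mem) (metis diff_ge_0_iff_ge)
    moreover have "y = ?T ?x"
      unfolding vec_eq_iff T using yp by (auto simp: u(3) split uk)
    ultimately show "y \<in> ?T ` prism k (corner_simplex k)" by blast
  next
    fix y assume "y \<in> ?T ` prism k (corner_simplex k)"
    then obtain x where x: "x \<in> prism k (corner_simplex k)" and y: "y = ?T x" by blast
    define u where "u i = (if i = k then 1 - (\<Sum>i\<in>-{k}. x $ i) else x $ i)" for i
    have "(\<chi> j. \<Sum>i\<in>UNIV. u i * A $ i $ j) \<in> convex hull (rows A)"
      unfolding hull using x by (intro exI[of _ u]) (auto simp: mem u_def split)
    moreover have "delete_coordinate k y = delete_coordinate k (\<chi> j. \<Sum>i\<in>UNIV. u i * A $ i $ j)"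
      unfolding y delete_coordinate_def by (rule restrict_ext) (simp only: T, simp add: u_def split)
    moreover have "y $ k = x $ k"
      unfolding y T by simp
    ultimately show "y \<in> ?L"
      using x by (auto simp: prism_def)
  qed
  then show ?thesis by (simp add: image_image)
qed

text \<open>Passing to prisms turns the projected hull into a translated linear image of the prism
  over the corner simplex. The volume 1 / \<open>fact (card (- {k}))\<close> of that simplex cancels
  the normalizing factor.\<close>

lemma hyperplane_volume_convex_hull_rows:
  "hyperplane_volume k (convex hull (rows A)) = \<bar>det (edge_matrix k A)\<bar>"
proof -
  let ?M = "\<Pi>\<^sub>M i\<in>-{k}. (lborel :: real measure)"
  let ?S = "delete_coordinate k ` (convex hull (rows A))"
  let ?Q = "prism k (corner_simplex k)"
  have S: "?S \<in> sets ?M"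
    by (intro sets_delete_coordinate_compact finite_imp_compact_convex_hull) (simp add: rows_def full_SetCompr_eq)
  have leb: "measure lebesgue (prism k X) = measure ?M X" if "X \<in> sets ?M" for X
    using that by (simp add: measure_def emeasure_prism sets_prism)
  have Q: "?Q \<in> lmeasurable"
    using sets_prism[OF sets_corner_simplex[of k]]
    by (intro fmeasurableI) (auto simp: emeasure_prism sets_corner_simplex emeasure_corner_simplex)
  have "measure ?M ?S = measure lebesgue ((*v) (transpose (edge_matrix k A)) ` ?Q)"
    by (simp add: measure_translation prism_convex_hull_rows flip: leb[OF S])
  also have "\<dots> = \<bar>det (edge_matrix k A)\<bar> * measure lebesgue ?Q"
    using measure_linear_image_finite[OF matrix_vector_mul_linear Q, of "transpose (edge_matrix k A)"]
    by (simp only: matrix_of_matrix_vector_mul det_transpose)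
  also have "measure lebesgue ?Q = 1 / fact (card (- {k}))"
    by (simp add: leb sets_corner_simplex) (simp add: measure_def emeasure_corner_simplex)
  finally show ?thesis
    by (simp add: hyperplane_volume_def normalized_volume_def)
qed

section \<open>Volume of the Laplacian polytope\<close>

lemma laplacian_row_sum:
  fixes D :: "('n::finite, 'e) pre_digraph"
  assumes "finite (arcs D)"
  shows "(\<Sum>j\<in>UNIV. laplacian D $ i $ j) = 0"
proof -
  have "out_arcs D i = (\<Union>j. {e \<in> arcs D. tail D e = i \<and> head D e = j})"
    by (auto simp: out_arcs_def)
  then have "out_degree D i = (\<Sum>j\<in>UNIV. card {e \<in> arcs D. tail D e = i \<and> head D e = j})"
    unfolding out_degree_def using assms by (simp only:) (intro card_UN_disjoint, auto)
  then show ?thesis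
    by (simp add: laplacian_def outdegree_matrix_def adjacency_matrix_def sum_subtractf)
qed

theorem proposition7:
  fixes D :: "('n::finite, 'e) pre_digraph" and k :: 'n
  assumes "multi_digraph D"
    and "complexity D > 0"
  shows "hyperplane_volume k (laplacian_polytope D) = real (complexity D)"
proof -
  interpret multi_digraph D by fact
  have "hyperplane_volume k (laplacian_polytope D) = \<bar>det (\<chi> i. laplacian D $ i + axis k 1)\<bar>"
    by (simp add: laplacian_polytope_def hyperplane_volume_convex_hull_rows det_edge_matrix
        laplacian_row_sum)
  \<comment> \<open>The determinant counts trees, so it is nonnegative and the absolute value
    disappears.\<close>
  then show ?thesis
    by (simp add: det_laplacian_plus_axis complexity_eq_card_tree_choices)
qed

end
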